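(* Let $X$ and $U$ be nonempty sets, let $\mathcal{A}$ be a $\sigma$-algebra on $X$ that is given by a countable partition of $X$, and let $\mathcal{F},\mathcal{G}$ be $\sigma$-algebras on $U$. Then $$(\mathcal{A}\otimes\mathcal{F})\cap(\mathcal{A}\otimes\mathcal{G})=\mathcal{A}\otimes(\mathcal{F}\cap\mathcal{G}).$$
   Context: For $\sigma$-algebras $\mathcal{C}$ on a set $Y$ and $\mathcal{D}$ on a set $Z$, the product $\mathcal{C}\otimes\mathcal{D}$ is the smallest $\sigma$-algebra on $Y\times Z$ containing all rectangles $C\times D$ with $C\in\mathcal{C}$, $D\in\mathcal{D}$. A $\sigma$-algebra $\mathcal{C}$ is given by a countable partition if there are countably many (possibly finitely many) pairwise disjoint nonempty sets $C_1,C_2,\dots$ in $\mathcal{C}$ such that $\mathcal{C}$ is exactly the collection of all unions $\bigcup_{i\in I}C_i$, where $I$ ranges over all subsets of the index set. *)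

theory Defs
  imports "HOL-Analysis.Analysis"
begin

definition prod_sigma_algebra ::
  "'a set \<Rightarrow> 'a set set \<Rightarrow> 'b set \<Rightarrow> 'b set set \<Rightarrow> ('a \<times> 'b) set set" where
  "prod_sigma_algebra Y \<C> Z \<D> = sigma_sets (Y \<times> Z) {C \<times> D | C D. C \<in> \<C> \<and> D \<in> \<D>}"

text \<open>A family of pairwise disjoint nonempty sets has no repetitions, so the index set is
  dropped and unions over arbitrary index sets become unions of arbitrary subfamilies of P.\<close>

definition given_by_countable_partition :: "'a set \<Rightarrow> 'a set set \<Rightarrow> bool" where
  "given_by_countable_partition Y \<C> \<longleftrightarrow>
     (\<exists>P. countable P \<and> partition_on Y P \<and> P \<subseteq> \<C> \<and> \<C> = {\<Union>Q | Q. Q \<subseteq> P})"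

lemma prod_sigma_algebra_eq_sets_pair_measure:
  assumes "sigma_algebra Y \<C>" and "sigma_algebra Z \<D>"
  shows "prod_sigma_algebra Y \<C> Z \<D> = sets (sigma Y \<C> \<Otimes>\<^sub>M sigma Z \<D>)"
proof -
  interpret C: sigma_algebra Y \<C> by fact
  interpret D: sigma_algebra Z \<D> by fact
  show ?thesis
    by (simp add: prod_sigma_algebra_def sets_pair_measure C.space_closed D.space_closed
        C.sigma_sets_eq D.sigma_sets_eq)
qed

end

theory Submission
  imports Defs
begin

text \<open>The sections of a measurable set along \<open>X\<close> are measurable and constant on each atom of the
  partition. Hence a set in both products is the countable union of the rectangles formed by an
  atom and the section over it, and this section lies in \<open>\<F> \<inter> \<G>\<close>.\<close>

lemma prod_sigma_algebra_mono:
  assumes "\<D> \<subseteq> \<E>"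
  shows "prod_sigma_algebra Y \<C> Z \<D> \<subseteq> prod_sigma_algebra Y \<C> Z \<E>"
  unfolding prod_sigma_algebra_def using assms by (intro sigma_sets_mono') blast

lemma prod_sigma_algebra_subset:
  assumes "sigma_algebra Y \<C>" and "sigma_algebra Z \<D>"
    and "E \<in> prod_sigma_algebra Y \<C> Z \<D>"
  shows "E \<subseteq> Y \<times> Z"
proof -
  interpret C: sigma_algebra Y \<C> by fact
  interpret D: sigma_algebra Z \<D> by fact
  have "{C \<times> D | C D. C \<in> \<C> \<and> D \<in> \<D>} \<subseteq> Pow (Y \<times> Z)"
    using C.sets_into_space D.sets_into_space by blast
  then show ?thesis
    using assms(3) unfolding prod_sigma_algebra_def by (rule sigma_sets_into_sp)
qed

text \<open>Viewing the product as a pair measure space makes this the measurability of sections.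
  The point \<open>x\<close> is arbitrary: outside \<open>Y\<close> its section is empty, which
  still lies in \<open>\<D>\<close>.\<close>

lemma prod_sigma_algebra_section:
  assumes "sigma_algebra Y \<C>" and "sigma_algebra Z \<D>"
    and "E \<in> prod_sigma_algebra Y \<C> Z \<D>"
  shows "Pair x -` E \<in> \<D>"
proof -
  interpret D: sigma_algebra Z \<D> by fact
  have "E \<in> sets (sigma Y \<C> \<Otimes>\<^sub>M sigma Z \<D>)"
    using assms by (simp add: prod_sigma_algebra_eq_sets_pair_measure)
  then have "Pair x -` E \<in> sets (sigma Z \<D>)"
    by (rule sets_Pair1)
  then show ?thesis
    by (simp add: D.space_closed D.sigma_sets_eq)
qed

text \<open>Induction over the generated sigma-algebra. A rectangle has its second side or the empty
  set as section, according to whether the point lies in its first side, and \<open>indist\<close>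
  makes this the same for \<open>x\<close> and \<open>y\<close>. Complements are relative to
  \<open>Y \<times> Z\<close>, so that case uses that both points lie in \<open>Y\<close>. Unions
  commute with preimages.\<close>

lemma prod_sigma_algebra_section_eq:
  assumes "x \<in> Y" and "y \<in> Y" and indist: "\<And>C. C \<in> \<C> \<Longrightarrow> x \<in> C \<longleftrightarrow> y \<in> C"
    and "E \<in> prod_sigma_algebra Y \<C> Z \<D>"
  shows "Pair x -` E = Pair y -` E"
  using assms(4) unfolding prod_sigma_algebra_def
proof induction
  case (Basic E)
  then show ?case using indist by auto
next
  case (Compl E)
  then show ?case using assms(1,2) by auto
next
  case (Union A)
  then show ?case by (simp add: vimage_UN)
qed simp

text \<open>By disjointness \<open>p\<close> is the only block containing \<open>x\<close>. The
  right-hand side does not mention \<open>x\<close>, so all points of one block belong to the same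
  unions of blocks.\<close>

lemma partition_on_mem_Union_iff:
  assumes "partition_on Y P" and "p \<in> P" and "x \<in> p" and "Q \<subseteq> P"
  shows "x \<in> \<Union>Q \<longleftrightarrow> p \<in> Q"
proof
  assume "x \<in> \<Union>Q"
  then obtain q where "q \<in> Q" "x \<in> q" by blast
  moreover from this have "q = p"
    using assms disjointD[OF partition_onD2[OF assms(1)], of q p] by blast
  ultimately show "p \<in> Q" by simp
qed (use assms(3) in blast)

theorem theorem2p1:
  fixes X :: "'a set" and U :: "'b set"
    and \<A> :: "'a set set" and \<F> \<G> :: "'b set set"
  assumes "X \<noteq> {}" and "U \<noteq> {}"
    and "sigma_algebra X \<A>"
    and "given_by_countable_partition X \<A>"
    and "sigma_algebra U \<F>" and "sigma_algebra U \<G>"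
  shows "prod_sigma_algebra X \<A> U \<F> \<inter> prod_sigma_algebra X \<A> U \<G>
       = prod_sigma_algebra X \<A> U (\<F> \<inter> \<G>)"
proof
  show "prod_sigma_algebra X \<A> U (\<F> \<inter> \<G>)
      \<subseteq> prod_sigma_algebra X \<A> U \<F> \<inter> prod_sigma_algebra X \<A> U \<G>"
    by (simp add: prod_sigma_algebra_mono)
next
  obtain P where P: "countable P" "partition_on X P" "P \<subseteq> \<A>" "\<A> = {\<Union>Q | Q. Q \<subseteq> P}"
    using assms(4) unfolding given_by_countable_partition_def by blast
  have X: "X = \<Union>P" using P(2) by (rule partition_onD1)
  show "prod_sigma_algebra X \<A> U \<F> \<inter> prod_sigma_algebra X \<A> U \<G>
      \<subseteq> prod_sigma_algebra X \<A> U (\<F> \<inter> \<G>)"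
  proof
    fix E assume "E \<in> prod_sigma_algebra X \<A> U \<F> \<inter> prod_sigma_algebra X \<A> U \<G>"
    then have EF: "E \<in> prod_sigma_algebra X \<A> U \<F>" and EG: "E \<in> prod_sigma_algebra X \<A> U \<G>"
      by auto
    \<comment> \<open>The section of \<open>E\<close> over a chosen representative of the atom
      \<open>p\<close>.\<close>
    define S where "S p = Pair (SOME x. x \<in> p) -` E" for p
    \<comment> \<open>The representative depends only on \<open>p\<close>, so one and the same set
      is a section of \<open>E\<close> seen in either product, and hence lies in both
      \<open>\<F>\<close> and \<open>\<G>\<close>.\<close>
    have S: "S p \<in> \<F> \<inter> \<G>" for p
      unfolding S_def using prod_sigma_algebra_section[OF assms(3,5) EF]
        prod_sigma_algebra_section[OF assms(3,6) EG] by (rule IntI)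
    have sec: "Pair x -` E = S p" if "p \<in> P" "x \<in> p" for x p
      unfolding S_def
    \<comment> \<open>Constancy on an atom concerns only \<open>E\<close> and the first factor, so
      membership in one of the two products is enough.\<close>
    proof (rule prod_sigma_algebra_section_eq[OF _ _ _ EF])
      have some: "(SOME x. x \<in> p) \<in> p" using that(2) by (rule someI)
      then show "x \<in> X" "(SOME x. x \<in> p) \<in> X" using that X by auto
      fix C assume "C \<in> \<A>"
      then obtain Q where "C = \<Union>Q" "Q \<subseteq> P" using P(4) by blast
      \<comment> \<open>Both sides amount to \<open>p \<in> Q\<close>: a member of
        \<open>\<A>\<close> contains the atom \<open>p\<close> or misses it entirely.\<close>
      then show "x \<in> C \<longleftrightarrow> (SOME x. x \<in> p) \<in> C"
        using partition_on_mem_Union_iff[OF P(2) that(1) that(2)]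
          partition_on_mem_Union_iff[OF P(2) that(1) some] by metis
    qed
    have "E \<subseteq> X \<times> U" by (rule prod_sigma_algebra_subset[OF assms(3,5) EF])
    have "E = (\<Union>p\<in>P. p \<times> S p)"
    proof (intro set_eqI iffI)
      fix z assume "z \<in> E"
      moreover from this obtain p where "p \<in> P" "fst z \<in> p"
        using \<open>E \<subseteq> X \<times> U\<close> X by fastforce
      moreover from this have "Pair (fst z) -` E = S p" by (rule sec)
      ultimately show "z \<in> (\<Union>p\<in>P. p \<times> S p)" by (cases z) auto
    next
      fix z assume "z \<in> (\<Union>p\<in>P. p \<times> S p)"
      then obtain p where "p \<in> P" "fst z \<in> p" "snd z \<in> S p" by auto
      then show "z \<in> E" using sec[of p "fst z"] by (cases z) auto
    qed
    also have "\<dots> \<in> prod_sigma_algebra X \<A> U (\<F> \<inter> \<G>)"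
      unfolding prod_sigma_algebra_def
    \<comment> \<open>Countability of the partition enters here: there is one rectangle per atom,
      and each is a generator of the product with \<open>\<F> \<inter> \<G>\<close>.\<close>
    proof (rule sigma_sets_UNION)
      show "countable ((\<lambda>p. p \<times> S p) ` P)" using P(1) by simp
      fix R assume "R \<in> (\<lambda>p. p \<times> S p) ` P"
      then show "R \<in> sigma_sets (X \<times> U) {C \<times> D | C D. C \<in> \<A> \<and> D \<in> \<F> \<inter> \<G>}"
        using P(3) S by (intro sigma_sets.Basic) blast
    qed
    finally show "E \<in> prod_sigma_algebra X \<A> U (\<F> \<inter> \<G>)" .
  qed
qed

end
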